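(* Let $n\ge 1$, let $E\subset\mathbb{R}^n$ be closed, and for $1\le k\le n+1$ denote by $M_k$ the $k$-medial axis of $E$; put $M_{n+2}=\emptyset$. For $0\le i\le n$ let $L_i=M_{n-i+1}\setminus M_{n-i+2}$. Then for each $1\le k\le n$, the $k$-medial axis $M_k$ is the disjoint union $$M_k=\bigcup_{i=0}^{n-k+1}L_i$$ (the sets $L_i$, $0\le i\le n-k+1$, being pairwise disjoint), and each $L_i$ with $0\le i\le n-k+1$ is $i$-rectifiable.
   Context: For $x,y\in\mathbb{R}^n$, $d(x,y)$ is the Euclidean distance. For a closed set $E\subset\mathbb{R}^n$ and $x\in\mathbb{R}^n$, set $d(x)=d(x,E)=\inf\{d(x,y):y\in E\}$ and let $\phi(x)=\{y\in E: d(x,y)=d(x)\}$ be the set of points of $E$ closest to $x$. For a positive integer $k$ with $1\le k\le n+1$, the $k$-medial axis $M_k=M_k(E)$ is the set of $x\in\mathbb{R}^n$ such that $\phi(x)$ contains $k$ points not all lying in a $(k-2)$-dimensional affine plane, i.e. $k$ affinely independent points (for $k=1$ this just means $\phi(x)\ne\emptyset$). A set $S\subset\mathbb{R}^n$ is $m$-rectifiable if there are countably many Lipschitz maps $f_j:\mathbb{R}^m\to\mathbb{R}^n$ such that $\mathcal{H}^m\left(S\setminus\bigcup_j f_j(\mathbb{R}^m)\right)=0$, where $\mathcal{H}^m$ is $m$-dimensional Hausdorff measure (for $m=0$: $S$ is countable). *)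

theory Defs
  imports "HOL-Analysis.Analysis"
begin

definition closest_points :: "'a::metric_space set \<Rightarrow> 'a \<Rightarrow> 'a set" where
  "closest_points E x = {y \<in> E. dist x y = infdist x E}"

definition medial_axis :: "'a::euclidean_space set \<Rightarrow> nat \<Rightarrow> 'a set" where
  "medial_axis E k =
     {x. \<exists>P \<subseteq> closest_points E x. finite P \<and> card P = k \<and> \<not> affine_dependent P}"

lemma affine_independent_iff_not_in_flat:
  fixes P :: "'a::euclidean_space set"
  assumes "finite P" and "card P = k" and "1 \<le> k" and "k \<le> DIM('a) + 1"
  shows "\<not> affine_dependent P \<longleftrightarrow>
           \<not> (\<exists>A. affine A \<and> aff_dim A = int k - 2 \<and> P \<subseteq> A)"
proof
  assume "\<not> affine_dependent P"
  then have "aff_dim P = int k - 1"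
    using assms(2) affine_independent_iff_card[of P] by simp
  then have "aff_dim A \<noteq> int k - 2" if "P \<subseteq> A" for A
    using aff_dim_subset[OF that] by linarith
  then show "\<not> (\<exists>A. affine A \<and> aff_dim A = int k - 2 \<and> P \<subseteq> A)"
    by blast
next
  assume flat: "\<not> (\<exists>A. affine A \<and> aff_dim A = int k - 2 \<and> P \<subseteq> A)"
  show "\<not> affine_dependent P"
  proof
    assume dep: "affine_dependent P"
    obtain B where B: "\<not> affine_dependent B" "B \<subseteq> P" "affine hull P = affine hull B"
      using affine_basis_exists[of P] by blast
    have "B \<noteq> P" using B(1) dep by blast
    then have "B \<subset> P" using B(2) by blast
    then have "card B < k"
      unfolding assms(2)[symmetric] by (rule psubset_card_mono[OF assms(1)])
    obtain T where T: "\<not> affine_dependent T" "B \<subseteq> T" "affine hull T = affine hull (UNIV::'a set)"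
      by (rule extend_to_affine_basis[OF B(1) subset_UNIV])
    have "finite T" using aff_independent_finite[OF T(1)] .
    have "aff_dim T = int (DIM('a))"
    proof -
      have "aff_dim T = aff_dim (affine hull T)" by (rule aff_dim_affine_hull[symmetric])
      also have "\<dots> = int (DIM('a))" unfolding T(3) by simp
      finally show ?thesis .
    qed
    then have "card T = DIM('a) + 1" using aff_dim_affine_independent[OF T(1)] by linarith
    then have "card B \<le> k - 1" "k - 1 \<le> card T" using \<open>card B < k\<close> assms(4) by linarith+
    then obtain C where C: "B \<subseteq> C" "C \<subseteq> T" "card C = k - 1"
      using exists_subset_between[OF _ _ T(2) \<open>finite T\<close>] by metis
    have "\<not> affine_dependent C" using affine_dependent_subset[OF _ C(2)] T(1) by blast
    then have "aff_dim C = int (card C) - 1"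
      using affine_independent_iff_card[of C] by blast
    then have "aff_dim C = int k - 2" unfolding C(3) using assms(3) by linarith
    moreover have "P \<subseteq> affine hull C"
      using hull_subset[of P affine] hull_mono[OF C(1), of affine] unfolding B(3) by (rule subset_trans)
    ultimately have "affine (affine hull C) \<and> aff_dim (affine hull C) = int k - 2 \<and> P \<subseteq> affine hull C"
      by simp
    then show False using flat by blast
  qed
qed

lemma medial_axis_flat:
  fixes E :: "'a::euclidean_space set"
  assumes "1 \<le> k" and "k \<le> DIM('a) + 1"
  shows "medial_axis E k =
     {x. \<exists>P \<subseteq> closest_points E x. finite P \<and> card P = k \<and>
           \<not> (\<exists>A. affine A \<and> aff_dim A = int k - 2 \<and> P \<subseteq> A)}"
  unfolding medial_axis_def
  by (intro Collect_cong ex_cong1) (use affine_independent_iff_not_in_flat[OF _ _ assms] in blast)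

lemma medial_axis_Suc_0:
  fixes E :: "'a::euclidean_space set"
  shows "medial_axis E (Suc 0) = {x. closest_points E x \<noteq> {}}"
proof -
  have "(\<exists>P\<subseteq>A. finite P \<and> card P = Suc 0 \<and> \<not> affine_dependent P) \<longleftrightarrow> A \<noteq> {}" for A :: "'a set"
  proof
    show "A \<noteq> {}" if "\<exists>P\<subseteq>A. finite P \<and> card P = Suc 0 \<and> \<not> affine_dependent P"
      using that by auto
    assume "A \<noteq> {}"
    then obtain a where "{a} \<subseteq> A" by blast
    then show "\<exists>P\<subseteq>A. finite P \<and> card P = Suc 0 \<and> \<not> affine_dependent P"
      by (intro exI[of _ "{a}"]) simp
  qed
  then show ?thesis by (simp add: medial_axis_def)
qed

lemma medial_axis_DIM_add_2:
  fixes E :: "'a::euclidean_space set"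
  shows "medial_axis E (DIM('a) + 2) = {}"
proof -
  have "card P \<le> DIM('a) + 1" if "\<not> affine_dependent P" for P :: "'a set"
    using aff_dim_affine_independent[OF that] aff_dim_le_DIM[of P] by linarith
  then have "\<not> (card P = DIM('a) + 2 \<and> \<not> affine_dependent P)" for P :: "'a set"
    by force
  then show ?thesis unfolding medial_axis_def by blast
qed

text \<open>By the last lemma the convention \<open>M\<^sub>n\<^sub>+\<^sub>2 = {}\<close>, relevant to the layer \<open>i = 0\<close>, needs no
  separate clause.\<close>

definition medial_layer :: "(real ^ 'n) set \<Rightarrow> nat \<Rightarrow> (real ^ 'n) set" where
  "medial_layer E i = medial_axis E (CARD('n) - i + 1) - medial_axis E (CARD('n) - i + 2)"

text \<open>Boundedness is required because \<^const>\<open>diameter\<close> is meaningless on unbounded sets.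
  The empty set must weigh \<open>0\<close> also for \<open>m = 0\<close>, where \<open>0 ^ 0 = 1\<close>; this makes the
  \<open>0\<close>-dimensional measure the counting measure.\<close>

definition hausdorff_weight :: "nat \<Rightarrow> 'a::metric_space set \<Rightarrow> ennreal" where
  "hausdorff_weight m U =
     (if U = {} then 0 else ennreal (unit_ball_vol (real m) * (diameter U / 2) ^ m))"

definition hausdorff_measure :: "nat \<Rightarrow> 'a::metric_space set \<Rightarrow> ennreal" where
  "hausdorff_measure m S =
     (SUP \<delta>\<in>{0<..}. INF U\<in>{U :: nat \<Rightarrow> 'a set.
        S \<subseteq> (\<Union>j. U j) \<and> (\<forall>j. bounded (U j) \<and> diameter (U j) \<le> \<delta>)}.
          \<Sum>j. hausdorff_weight m (U j))"

text \<open>As \<open>m\<close> is a term, \<open>\<real>\<^sup>m\<close> is the carrier of \<^const>\<open>Euclidean_space\<close>, i.e. the sequences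
  vanishing from index \<open>m\<close> on. The metric is spelled out because the class instance on
  functions \<open>nat \<Rightarrow> real\<close> is not the Euclidean one.\<close>

definition lipschitz_from_Rm :: "nat \<Rightarrow> ((nat \<Rightarrow> real) \<Rightarrow> 'a::metric_space) \<Rightarrow> bool" where
  "lipschitz_from_Rm m f \<longleftrightarrow>
     (\<exists>C. \<forall>x\<in>topspace (Euclidean_space m). \<forall>y\<in>topspace (Euclidean_space m).
        dist (f x) (f y) \<le> C * L2_set (\<lambda>i. x i - y i) {..<m})"

definition m_rectifiable :: "nat \<Rightarrow> 'a::metric_space set \<Rightarrow> bool" where
  "m_rectifiable m S \<longleftrightarrow>
     (if m = 0 then countable S
      else \<exists>f :: nat \<Rightarrow> (nat \<Rightarrow> real) \<Rightarrow> 'a.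
        (\<forall>j. lipschitz_from_Rm m (f j)) \<and>
        hausdorff_measure m (S - (\<Union>j. f j ` topspace (Euclidean_space m))) = 0)"

end

theory Submission
  imports Defs
begin

text \<open>
  Put \<open>f x = |x|\<^sup>2 - d(x)\<^sup>2\<close>.  A point \<open>y\<close> of \<open>E\<close> satisfies \<open>f x \<ge> 2 x\<bullet>y - |y|\<^sup>2\<close> for all
  \<open>x\<close>, with equality when \<open>y\<close> is closest to \<open>x\<close>; so closest points are, up to the factor 2,
  subgradients of \<open>f\<close>.  Consequently, if \<open>x\<close> and \<open>x'\<close> both have closest points within \<open>r\<close> of
  \<open>p\<close> and closest points within \<open>r\<close> of \<open>q\<close>, then \<open>f x - f x'\<close> differs from both
  \<open>2 (x - x')\<bullet>p\<close> and \<open>2 (x - x')\<bullet>q\<close> by at most \<open>2 r |x - x'|\<close>, whence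
  \<open>|(x - x')\<bullet>(p - q)| \<le> 2 r |x - x'|\<close> (\<open>inner_diff_near_closest\<close>).

  Let \<open>P\<close> be a set of \<open>k\<close> affinely independent points.  If \<open>r\<close> is small, this cone condition for
  all \<open>p, q \<in> P\<close> says that \<open>x - x'\<close> is nearly orthogonal to a space of dimension \<open>k - 1\<close>.
  Completing \<open>P\<close> to an affine basis yields \<open>m = n + 1 - k\<close> further directions whose inner
  products control \<open>|x - x'|\<close> (\<open>norm_le_sum_inner\<close>), so that the set of points having a closest
  point near every \<open>p \<in> P\<close> is the image under a Lipschitz map of a subset of \<open>\<real>\<^sup>m\<close>.
  Extending this map to \<open>\<real>\<^sup>m\<close> componentwise (\<open>lipschitz_graph_covered\<close>) and letting the
  neighbourhoods of the points of \<open>P\<close> range over a countable base of the topology covers the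
  whole \<open>k\<close>-medial axis by countably many Lipschitz images of \<open>\<real>\<^sup>m\<close>, without an exceptional
  null set.  For \<open>m = 0\<close> each piece is at most a point.

  The decomposition into layers is formal, since the medial axes decrease in \<open>k\<close> and the
  \<open>(n + 2)\<close>-medial axis is empty.
\<close>

section \<open>Closest points and the cone condition\<close>

lemma closest_point_subgradient:
  fixes E :: "'a::euclidean_space set"
  assumes "y \<in> closest_points E x"
  shows "(x \<bullet> x - (infdist x E)\<^sup>2) - (x' \<bullet> x' - (infdist x' E)\<^sup>2) \<le> 2 * ((x - x') \<bullet> y)"
proof -
  have y: "y \<in> E" "infdist x E = dist x y"
    using assms by (auto simp: closest_points_def)
  have "(infdist x' E)\<^sup>2 \<le> (dist x' y)\<^sup>2"
    by (intro power_mono infdist_le y(1) infdist_nonneg)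
  moreover have "(dist z y)\<^sup>2 = z \<bullet> z - 2 * (z \<bullet> y) + y \<bullet> y" for z
    by (simp add: dist_norm power2_norm_eq_inner algebra_simps inner_commute)
  ultimately show ?thesis
    by (simp add: y(2) inner_diff_left)
qed

lemma inner_diff_near_closest:
  fixes E :: "'a::euclidean_space set"
  assumes "\<And>z s. z \<in> {x, x'} \<Longrightarrow> s \<in> {p, q} \<Longrightarrow> closest_points E z \<inter> ball s r \<noteq> {}"
  shows "\<bar>(x - x') \<bullet> (p - q)\<bar> \<le> 2 * r * norm (x - x')"
proof -
  define f where "f x = x \<bullet> x - (infdist x E)\<^sup>2" for x
  have upper: "f z - f z' \<le> 2 * ((z - z') \<bullet> s) + 2 * r * norm (z - z')"
    if near: "closest_points E z \<inter> ball s r \<noteq> {}" for z z' s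
  proof -
    obtain y where y: "y \<in> closest_points E z" "dist s y < r"
      using near by auto
    have "(z - z') \<bullet> (y - s) \<le> norm (z - z') * norm (y - s)"
      by (rule norm_cauchy_schwarz)
    also have "\<dots> \<le> norm (z - z') * r"
      using y(2) by (intro mult_left_mono) (auto simp: dist_norm norm_minus_commute)
    finally show ?thesis
      using closest_point_subgradient[OF y(1), of z'] by (simp add: f_def algebra_simps)
  qed
  have "f x - f x' \<le> 2 * ((x - x') \<bullet> s) + 2 * r * norm (x - x')"
       "2 * ((x - x') \<bullet> s) - 2 * r * norm (x - x') \<le> f x - f x'" if "s \<in> {p, q}" for s
    using upper[of x s x'] upper[of x' s x] assms that
    by (auto simp: norm_minus_commute inner_diff_left algebra_simps)
  from this[of p] this[of q] show ?thesis
    by (simp add: inner_diff_right abs_le_iff)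
qed

text \<open>The directions \<open>w i\<close> complete the nonzero differences \<open>p - a\<close> to a basis of the space.\<close>

lemma norm_le_sum_inner:
  fixes P :: "'a::euclidean_space set"
  assumes "\<not> affine_dependent P" and "a \<in> P"
  obtains w \<delta> where "\<delta> > 0"
    and "\<And>u. \<delta> * norm u \<le> (\<Sum>i<DIM('a) + 1 - card P. \<bar>u \<bullet> w i\<bar>) + (\<Sum>p\<in>P. \<bar>u \<bullet> (p - a)\<bar>)"
proof -
  obtain T where T: "\<not> affine_dependent T" "P \<subseteq> T" "affine hull T = (UNIV :: 'a set)"
    using extend_to_affine_basis[OF assms(1) subset_UNIV] by (metis hull_UNIV)
  have fin: "finite T" "finite P"
    using aff_independent_finite T(1) assms(1) by blast+
  have "aff_dim T = int DIM('a)"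
    using T(3) by (metis aff_dim_affine_hull aff_dim_UNIV)
  then have "card T = DIM('a) + 1"
    using aff_dim_affine_independent[OF T(1)] by linarith
  then have "card (T - P) = DIM('a) + 1 - card P"
    using fin T(2) by (simp add: card_Diff_subset)
  then obtain h where h: "bij_betw h {..<DIM('a) + 1 - card P} (T - P)"
    using fin(1) by (metis finite_Diff bij_betw_from_nat_into_finite)
  define g where "g u = (\<Sum>t\<in>T. \<bar>u \<bullet> (t - a)\<bar>)" for u
  have split: "g u = (\<Sum>i<DIM('a) + 1 - card P. \<bar>u \<bullet> (h i - a)\<bar>) + (\<Sum>p\<in>P. \<bar>u \<bullet> (p - a)\<bar>)" for u
    unfolding g_def sum.subset_diff[OF T(2) fin(1)]
    using sum.reindex_bij_betw[OF h, of "\<lambda>t. \<bar>u \<bullet> (t - a)\<bar>"] by simp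
  have pos: "g u > 0" if "u \<noteq> 0" for u
  proof (rule ccontr)
    assume "\<not> g u > 0"
    then have "g u = 0"
      unfolding g_def by (metis abs_ge_zero sum_nonneg less_eq_real_def)
    then have "T \<subseteq> {z. u \<bullet> z = u \<bullet> a}"
      using fin(1) by (auto simp: g_def sum_nonneg_eq_0_iff inner_diff_right)
    then have "affine hull T \<subseteq> {z. u \<bullet> z = u \<bullet> a}"
      by (intro hull_minimal affine_hyperplane)
    then have "u \<bullet> (a + u) = u \<bullet> a"
      unfolding T(3) by blast
    then show False
      using that by (simp add: inner_add_right)
  qed
  have "continuous_on (sphere 0 1) g"
    unfolding g_def by (intro continuous_intros)
  moreover have "sphere (0::'a) 1 \<noteq> {}"
    by simp
  ultimately obtain v where v: "v \<in> sphere 0 1" "\<And>u. u \<in> sphere 0 1 \<Longrightarrow> g v \<le> g u"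
    using continuous_attains_inf[OF compact_sphere] by metis
  show ?thesis
  proof (rule that[of "g v" "\<lambda>i. h i - a"])
    show "g v > 0"
      using v(1) by (intro pos) auto
    show "g v * norm u \<le> (\<Sum>i<DIM('a) + 1 - card P. \<bar>u \<bullet> (h i - a)\<bar>) + (\<Sum>p\<in>P. \<bar>u \<bullet> (p - a)\<bar>)" for u
    proof (cases "u = 0")
      case False
      have "g u = norm u * g (u /\<^sub>R norm u)"
        using False by (simp add: g_def sum_distrib_left abs_mult flip: mult.assoc)
      moreover have "g v \<le> g (u /\<^sub>R norm u)"
        using False by (intro v(2)) simp
      ultimately show ?thesis
        unfolding split[symmetric] by (simp add: mult.commute mult_left_mono)
    qed simp
  qed
qed

section \<open>Lipschitz graphs over coordinate spaces\<close>

text \<open>A set whose points are separated, in the bi-Lipschitz sense, by \<open>m\<close> linear functionals: the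
  inverse of \<open>x \<mapsto> (x \<bullet> w i)\<^sub>i\<close> is Lipschitz on the image of the set.\<close>

definition lipschitz_graph :: "nat \<Rightarrow> 'a::euclidean_space set \<Rightarrow> bool" where
  "lipschitz_graph m S \<longleftrightarrow>
     (\<exists>w C. \<forall>x\<in>S. \<forall>y\<in>S. norm (x - y) \<le> C * (\<Sum>i<m. \<bar>(x - y) \<bullet> w i\<bar>))"

lemma lipschitz_graph_0:
  assumes "lipschitz_graph 0 S"
  shows "countable S"
proof -
  have "x = y" if "x \<in> S" "y \<in> S" for x y
    using assms that by (force simp: lipschitz_graph_def)
  then have "S \<subseteq> {SOME x. x \<in> S}"
    by (metis someI singletonI subsetI)
  then show ?thesis
    by (meson countable_finite finite.intros finite_subset)
qed

text \<open>McShane's extension, applied to each component of the inverse of \<open>x \<mapsto> (x \<bullet> w i)\<^sub>i\<close>.\<close>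

lemma lipschitz_graph_covered:
  fixes S :: "'a::euclidean_space set"
  assumes "lipschitz_graph m S"
  obtains f :: "(nat \<Rightarrow> real) \<Rightarrow> 'a"
  where "lipschitz_from_Rm m f" and "S \<subseteq> f ` topspace (Euclidean_space m)"
proof (cases "S = {}")
  case True
  have "lipschitz_from_Rm m (\<lambda>_. 0 :: 'a)"
    unfolding lipschitz_from_Rm_def by (rule exI[of _ 0]) simp
  then show ?thesis
    using True that by blast
next
  case False
  then obtain s0 where s0: "s0 \<in> S"
    by blast
  obtain w C where C: "\<And>x y. x \<in> S \<Longrightarrow> y \<in> S \<Longrightarrow> norm (x - y) \<le> C * (\<Sum>i<m. \<bar>(x - y) \<bullet> w i\<bar>)"
    using assms unfolding lipschitz_graph_def by blast
  define \<pi> where "\<pi> x i = (if i < m then x \<bullet> w i else 0)" for x i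
  define d where "d z z' = L2_set (\<lambda>i. z i - z' i) {..<m}" for z z' :: "nat \<Rightarrow> real"
  define K where "K = \<bar>C\<bar> * real m"
  have K: "K \<ge> 0"
    by (simp add: K_def)
  have d_commute: "d z z' = d z' z" for z z'
    by (simp add: d_def L2_set_def power2_commute)
  have d_triangle: "d z z'' \<le> d z z' + d z' z''" for z z' z''
    unfolding d_def using L2_set_triangle_ineq[of "\<lambda>i. z i - z' i" "\<lambda>i. z' i - z'' i" "{..<m}"]
    by simp
  have d_refl: "d z z = 0" for z
    by (simp add: d_def L2_set_def)
  have inverse_lipschitz: "norm (x - y) \<le> K * d (\<pi> x) (\<pi> y)" if "x \<in> S" "y \<in> S" for x y
  proof -
    have "(\<Sum>i<m. \<bar>(x - y) \<bullet> w i\<bar>) \<le> (\<Sum>i<m. d (\<pi> x) (\<pi> y))"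
    proof (rule sum_mono)
      fix i assume i: "i \<in> {..<m}"
      have "\<bar>\<pi> x i - \<pi> y i\<bar> \<le> L2_set (\<lambda>i. \<bar>\<pi> x i - \<pi> y i\<bar>) {..<m}"
        using i by (intro member_le_L2_set) auto
      then show "\<bar>(x - y) \<bullet> w i\<bar> \<le> d (\<pi> x) (\<pi> y)"
        using i by (simp add: d_def \<pi>_def inner_diff_left L2_set_def)
    qed
    then have "\<bar>C\<bar> * (\<Sum>i<m. \<bar>(x - y) \<bullet> w i\<bar>) \<le> \<bar>C\<bar> * (real m * d (\<pi> x) (\<pi> y))"
      by (intro mult_left_mono) auto
    moreover have "C * (\<Sum>i<m. \<bar>(x - y) \<bullet> w i\<bar>) \<le> \<bar>C\<bar> * (\<Sum>i<m. \<bar>(x - y) \<bullet> w i\<bar>)"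
      by (intro mult_right_mono sum_nonneg) auto
    ultimately show ?thesis
      using C[OF that] by (simp add: K_def mult.assoc)
  qed
  define F where "F b z = (INF s\<in>S. s \<bullet> b + K * d z (\<pi> s))" for b z
  have comp: "\<bar>s \<bullet> b - t \<bullet> b\<bar> \<le> K * d (\<pi> s) (\<pi> t)" if "s \<in> S" "t \<in> S" "b \<in> Basis" for s t b
    using inverse_lipschitz[OF that(1,2)] Basis_le_norm[OF that(3), of "s - t"]
    by (simp add: inner_diff_left)
  have bdd: "bdd_below ((\<lambda>s. s \<bullet> b + K * d z (\<pi> s)) ` S)" if "b \<in> Basis" for b z
  proof (rule bdd_belowI2)
    fix s assume "s \<in> S"
    then have "\<bar>s \<bullet> b - s0 \<bullet> b\<bar> \<le> K * d (\<pi> s) (\<pi> s0)"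
      using comp s0 that by blast
    also have "\<dots> \<le> K * (d z (\<pi> s) + d z (\<pi> s0))"
      using d_triangle[of "\<pi> s" "\<pi> s0" z] d_commute K by (intro mult_left_mono) auto
    finally show "s0 \<bullet> b - K * d z (\<pi> s0) \<le> s \<bullet> b + K * d z (\<pi> s)"
      by (simp add: algebra_simps)
  qed
  have F_le: "F b z \<le> F b z' + K * d z z'" if "b \<in> Basis" for b z z'
  proof -
    have "F b z - K * d z z' \<le> s \<bullet> b + K * d z' (\<pi> s)" if "s \<in> S" for s
    proof -
      have "F b z \<le> s \<bullet> b + K * d z (\<pi> s)"
        unfolding F_def by (intro cINF_lower bdd \<open>b \<in> Basis\<close> that)
      also have "\<dots> \<le> s \<bullet> b + K * (d z z' + d z' (\<pi> s))"
        using d_triangle K by (intro add_left_mono mult_left_mono) auto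
      finally show ?thesis
        by (simp add: algebra_simps)
    qed
    then have "F b z - K * d z z' \<le> F b z'"
      unfolding F_def[of b z'] using False by (intro cINF_greatest) auto
    then show ?thesis
      by simp
  qed
  have F_\<pi>: "F b (\<pi> s) = s \<bullet> b" if "b \<in> Basis" "s \<in> S" for b s
  proof (rule antisym)
    show "F b (\<pi> s) \<le> s \<bullet> b"
      using cINF_lower[OF bdd[OF that(1), of "\<pi> s"] that(2)] by (simp add: F_def d_refl)
    show "s \<bullet> b \<le> F b (\<pi> s)"
      unfolding F_def using False comp[OF that(2) _ that(1)]
      by (intro cINF_greatest) (force simp: abs_le_iff)+
  qed
  define f where "f z = (\<Sum>b\<in>Basis. F b z *\<^sub>R b)" for z
  show ?thesis
  proof (rule that)
    show "lipschitz_from_Rm m f"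
      unfolding lipschitz_from_Rm_def d_def[symmetric]
    proof (intro exI ballI)
      fix z z' :: "nat \<Rightarrow> real"
      have "dist (f z) (f z') = norm (\<Sum>b\<in>Basis. (F b z - F b z') *\<^sub>R b)"
        by (simp add: f_def dist_norm sum_subtractf scaleR_diff_left)
      also have "\<dots> \<le> (\<Sum>b\<in>(Basis::'a set). K * d z z')"
      proof (rule sum_norm_le)
        fix b :: 'a assume b: "b \<in> Basis"
        show "norm ((F b z - F b z') *\<^sub>R b) \<le> K * d z z'"
          using F_le[OF b, of z z'] F_le[OF b, of z' z] d_commute[of z z'] b
          by (simp add: abs_le_iff)
      qed
      finally show "dist (f z) (f z') \<le> (DIM('a) * K) * d z z'"
        by simp
    qed
    show "S \<subseteq> f ` topspace (Euclidean_space m)"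
    proof
      fix s assume s: "s \<in> S"
      have "f (\<pi> s) = (\<Sum>b\<in>Basis. (s \<bullet> b) *\<^sub>R b)"
        unfolding f_def using s F_\<pi> by (intro sum.cong) auto
      moreover have "\<pi> s \<in> topspace (Euclidean_space m)"
        by (simp add: topspace_Euclidean_space \<pi>_def)
      ultimately show "s \<in> f ` topspace (Euclidean_space m)"
        by (simp add: euclidean_representation rev_image_eqI)
    qed
  qed
qed

lemma hausdorff_measure_empty: "hausdorff_measure m {} = 0"
proof -
  have "(INF U\<in>{U :: nat \<Rightarrow> 'a set. {} \<subseteq> (\<Union>j. U j) \<and> (\<forall>j. bounded (U j) \<and> diameter (U j) \<le> \<delta>)}.
          \<Sum>j. hausdorff_weight m (U j)) = 0" if "\<delta> > 0" for \<delta>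
  proof -
    have "(INF U\<in>{U :: nat \<Rightarrow> 'a set. {} \<subseteq> (\<Union>j. U j) \<and> (\<forall>j. bounded (U j) \<and> diameter (U j) \<le> \<delta>)}.
          \<Sum>j. hausdorff_weight m (U j)) \<le> (\<Sum>j. hausdorff_weight m ({} :: 'a set))"
      using that by (intro INF_lower2[where i = "\<lambda>_. {}"]) auto
    then show ?thesis
      by (simp add: hausdorff_weight_def)
  qed
  then show ?thesis
    unfolding hausdorff_measure_def by (simp cong: SUP_cong_simp)
qed

lemma m_rectifiable_if_covered:
  fixes S :: "'a::euclidean_space set"
  assumes "countable \<S>" and "\<And>T. T \<in> \<S> \<Longrightarrow> lipschitz_graph m T" and "S \<subseteq> \<Union>\<S>"
  shows "m_rectifiable m S"
proof (cases "m = 0")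
  case True
  then have "countable (\<Union>T\<in>\<S>. T)"
    using assms(1,2) lipschitz_graph_0 by (intro countable_UN) auto
  then show ?thesis
    using True assms(3) by (simp add: m_rectifiable_def countable_subset)
next
  case False
  \<comment> \<open>The empty graph makes the family nonempty, hence the range of a sequence.\<close>
  define T where "T = from_nat_into (insert {} \<S>)"
  have range: "range T = insert {} \<S>"
    using assms(1) by (simp add: T_def range_from_nat_into)
  have "lipschitz_graph m {}"
    by (simp add: lipschitz_graph_def)
  then have "lipschitz_graph m (T j)" for j
    using range assms(2) by (metis insert_iff rangeI)
  then have "\<forall>j. \<exists>f. lipschitz_from_Rm m f \<and> T j \<subseteq> f ` topspace (Euclidean_space m)"
    by (metis lipschitz_graph_covered)
  then obtain f where f: "\<And>j. lipschitz_from_Rm m (f j)"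
      "\<And>j. T j \<subseteq> f j ` topspace (Euclidean_space m)"
    by metis
  have "S \<subseteq> \<Union>(range T)"
    using assms(3) by (simp add: range)
  also have "\<dots> \<subseteq> (\<Union>j. f j ` topspace (Euclidean_space m))"
    by (intro UN_mono subset_refl f(2))
  finally have "S - (\<Union>j. f j ` topspace (Euclidean_space m)) = {}"
    by (simp only: Diff_eq_empty_iff)
  then have "(\<forall>j. lipschitz_from_Rm m (f j)) \<and>
      hausdorff_measure m (S - (\<Union>j. f j ` topspace (Euclidean_space m))) = 0"
    using f(1) by (metis hausdorff_measure_empty)
  then show ?thesis
    unfolding m_rectifiable_def if_not_P[OF False] by (intro exI[of _ f])
qed

section \<open>Medial axes\<close>

lemma medial_axis_point_nbhds:
  fixes E :: "'a::euclidean_space set"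
  assumes "topological_basis \<B>" and "x \<in> medial_axis E k" and "k \<ge> 1"
  obtains \<F> where "finite \<F>" "\<F> \<subseteq> \<B>" "\<And>B. B \<in> \<F> \<Longrightarrow> closest_points E x \<inter> B \<noteq> {}"
    and "lipschitz_graph (DIM('a) + 1 - k) {z. \<forall>B\<in>\<F>. closest_points E z \<inter> B \<noteq> {}}"
proof -
  obtain P where P: "P \<subseteq> closest_points E x" "finite P" "card P = k" "\<not> affine_dependent P"
    using assms(2) by (auto simp: medial_axis_def)
  then obtain a where a: "a \<in> P"
    using assms(3) by (metis card.empty not_one_le_zero ex_in_conv)
  obtain w \<delta> where \<delta>: "\<delta> > 0"
    "\<And>u. \<delta> * norm u \<le> (\<Sum>i<DIM('a) + 1 - k. \<bar>u \<bullet> w i\<bar>) + (\<Sum>p\<in>P. \<bar>u \<bullet> (p - a)\<bar>)"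
    using norm_le_sum_inner[OF P(4) a] P(3) by metis
  \<comment> \<open>With this radius the sum over \<open>P\<close> absorbs at most half of \<open>\<delta> * norm u\<close>.\<close>
  define r where "r = \<delta> / (4 * k)"
  have r: "r > 0"
    using \<delta>(1) assms(3) by (simp add: r_def)
  have "\<exists>B\<in>\<B>. p \<in> B \<and> B \<subseteq> ball p r" for p
    using topological_basisE[OF assms(1) open_ball, of p p r] r by (metis centre_in_ball)
  then obtain B where B: "\<And>p. B p \<in> \<B>" "\<And>p. p \<in> B p" "\<And>p. B p \<subseteq> ball p r"
    by metis
  show ?thesis
  proof (rule that[of "B ` P"])
    show "finite (B ` P)" "B ` P \<subseteq> \<B>"
      using P(2) B(1) by auto
    show "closest_points E x \<inter> U \<noteq> {}" if "U \<in> B ` P" for U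
      using that P(1) B(2) by blast
    have "norm (y - z) \<le> 2 / \<delta> * (\<Sum>i<DIM('a) + 1 - k. \<bar>(y - z) \<bullet> w i\<bar>)"
      if y: "\<forall>U\<in>B ` P. closest_points E y \<inter> U \<noteq> {}"
        and z: "\<forall>U\<in>B ` P. closest_points E z \<inter> U \<noteq> {}" for y z
    proof -
      have "(\<Sum>p\<in>P. \<bar>(y - z) \<bullet> (p - a)\<bar>) \<le> (\<Sum>p\<in>P. 2 * r * norm (y - z))"
      proof (intro sum_mono inner_diff_near_closest)
        fix p v s assume "p \<in> P" "v \<in> {y, z}" "s \<in> {p, a}"
        then have "closest_points E v \<inter> B s \<noteq> {}"
          using y z a by blast
        then show "closest_points E v \<inter> ball s r \<noteq> {}"
          using B(3) by blast
      qed
      also have "\<dots> = \<delta> / 2 * norm (y - z)"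
        using assms(3) P(3) by (simp add: r_def)
      finally show ?thesis
        using \<delta>(1) \<delta>(2)[of "y - z"] by (simp add: field_simps)
    qed
    then show "lipschitz_graph (DIM('a) + 1 - k) {z. \<forall>U\<in>B ` P. closest_points E z \<inter> U \<noteq> {}}"
      unfolding lipschitz_graph_def by (intro exI[of _ w] exI[of _ "2 / \<delta>"] ballI) (simp only: mem_Collect_eq)
  qed
qed

lemma m_rectifiable_subset_medial_axis:
  fixes E :: "'a::euclidean_space set"
  assumes "k \<ge> 1" and "S \<subseteq> medial_axis E k"
  shows "m_rectifiable (DIM('a) + 1 - k) S"
proof -
  obtain \<B> :: "'a set set" where \<B>: "countable \<B>" "topological_basis \<B>"
    using ex_countable_basis by blast
  define G where "G \<F> = {z. \<forall>B\<in>\<F>. closest_points E z \<inter> B \<noteq> {}}" for \<F>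
  show ?thesis
  proof (rule m_rectifiable_if_covered)
    show "countable (G ` {\<F>. finite \<F> \<and> \<F> \<subseteq> \<B> \<and> lipschitz_graph (DIM('a) + 1 - k) (G \<F>)})"
      by (intro countable_image countable_subset[OF _ countable_Collect_finite_subset[OF \<B>(1)]])
        blast
    show "S \<subseteq> \<Union>(G ` {\<F>. finite \<F> \<and> \<F> \<subseteq> \<B> \<and> lipschitz_graph (DIM('a) + 1 - k) (G \<F>)})"
    proof
      fix x assume "x \<in> S"
      then have "x \<in> medial_axis E k"
        using assms(2) by blast
      then show "x \<in> \<Union>(G ` {\<F>. finite \<F> \<and> \<F> \<subseteq> \<B> \<and> lipschitz_graph (DIM('a) + 1 - k) (G \<F>)})"
      proof (rule medial_axis_point_nbhds[OF \<B>(2) _ assms(1)])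
        fix \<F> assume \<F>: "finite \<F>" "\<F> \<subseteq> \<B>" "\<And>B. B \<in> \<F> \<Longrightarrow> closest_points E x \<inter> B \<noteq> {}"
          and "lipschitz_graph (DIM('a) + 1 - k) {z. \<forall>B\<in>\<F>. closest_points E z \<inter> B \<noteq> {}}"
        then have "lipschitz_graph (DIM('a) + 1 - k) (G \<F>)"
          by (simp only: G_def)
        moreover have "x \<in> G \<F>"
          using \<F>(3) by (simp add: G_def)
        ultimately show ?thesis
          using \<F>(1,2) by blast
      qed
    qed
  qed auto
qed

lemma medial_axis_antimono:
  assumes "j \<le> k"
  shows "medial_axis E k \<subseteq> medial_axis E j"
proof
  fix x assume "x \<in> medial_axis E k"
  then obtain P where P: "P \<subseteq> closest_points E x" "finite P" "card P = k" "\<not> affine_dependent P"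
    by (auto simp: medial_axis_def)
  obtain Q where Q: "Q \<subseteq> P" "card Q = j" "finite Q"
    using obtain_subset_with_card_n assms P(3) by metis
  then have "\<not> affine_dependent Q"
    using P(4) affine_dependent_subset by blast
  then show "x \<in> medial_axis E j"
    using P(1) Q unfolding medial_axis_def by blast
qed

lemma medial_axis_eq_Union_layers:
  fixes E :: "(real ^ 'n) set"
  assumes "1 \<le> k" and "k \<le> CARD('n) + 1"
  shows "medial_axis E k = (\<Union>i\<in>{0..CARD('n) + 1 - k}. medial_layer E i)"
proof (intro equalityI subsetI)
  fix x assume x: "x \<in> medial_axis E k"
  have bound: "j \<le> CARD('n) + 1" if "x \<in> medial_axis E j" for j
  proof (rule ccontr)
    assume "\<not> j \<le> CARD('n) + 1"
    then have "medial_axis E j \<subseteq> medial_axis E (CARD('n) + 2)"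
      by (intro medial_axis_antimono) simp
    then show False
      using that medial_axis_DIM_add_2[of E] by auto
  qed
  \<comment> \<open>The layer of \<open>x\<close> is determined by the largest \<open>j\<close> with \<open>x\<close> in the \<open>j\<close>-medial axis.\<close>
  obtain j where j: "x \<in> medial_axis E j" "\<And>l. x \<in> medial_axis E l \<Longrightarrow> l \<le> j"
    using Nat.ex_has_greatest_nat[of "\<lambda>j. x \<in> medial_axis E j" k "CARD('n) + 1"] x bound
    by blast
  have "k \<le> j" "j \<le> CARD('n) + 1"
    using j x bound by auto
  then have "CARD('n) - (CARD('n) + 1 - j) + 1 = j"
    using assms(1) by linarith
  moreover have "x \<notin> medial_axis E (j + 1)"
    using j(2)[of "j + 1"] by auto
  ultimately have "x \<in> medial_layer E (CARD('n) + 1 - j)"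
    using j(1) \<open>k \<le> j\<close> assms(1) unfolding medial_layer_def by (simp add: add.commute)
  then show "x \<in> (\<Union>i\<in>{0..CARD('n) + 1 - k}. medial_layer E i)"
    using \<open>k \<le> j\<close> by (intro UN_I[of "CARD('n) + 1 - j"]) auto
next
  fix x assume "x \<in> (\<Union>i\<in>{0..CARD('n) + 1 - k}. medial_layer E i)"
  then obtain i where i: "i \<le> CARD('n) + 1 - k" "x \<in> medial_axis E (CARD('n) - i + 1)"
    by (auto simp: medial_layer_def)
  have "k \<le> CARD('n) - i + 1"
    using i(1) assms by linarith
  then show "x \<in> medial_axis E k"
    using i(2) medial_axis_antimono by blast
qed

lemma medial_layers_disjoint:
  fixes E :: "(real ^ 'n) set"
  shows "disjoint_family_on (medial_layer E) {0..CARD('n)}"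
proof -
  have "medial_layer E i \<inter> medial_layer E j = {}" if "i < j" "j \<le> CARD('n)" for i j
  proof -
    have "medial_axis E (CARD('n) - i + 1) \<subseteq> medial_axis E (CARD('n) - j + 2)"
      using that by (intro medial_axis_antimono) linarith
    then show ?thesis
      unfolding medial_layer_def by blast
  qed
  then show ?thesis
    unfolding disjoint_family_on_def by (metis Int_commute atLeastAtMost_iff linorder_neqE_nat)
qed

theorem corollary2p28:
  fixes E :: "(real ^ 'n) set" and k :: nat
  assumes "closed E" and "1 \<le> k" and "k \<le> CARD('n)"
  shows "medial_axis E k = (\<Union>i\<in>{0..CARD('n) - k + 1}. medial_layer E i)
    \<and> disjoint_family_on (medial_layer E) {0..CARD('n) - k + 1}
    \<and> (\<forall>i\<in>{0..CARD('n) - k + 1}. m_rectifiable i (medial_layer E i))"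
proof (intro conjI ballI)
  have eq: "CARD('n) - k + 1 = CARD('n) + 1 - k"
    using assms(3) by simp
  show "medial_axis E k = (\<Union>i\<in>{0..CARD('n) - k + 1}. medial_layer E i)"
    unfolding eq using assms by (intro medial_axis_eq_Union_layers) auto
  have sub: "{0..CARD('n) - k + 1} \<subseteq> {0..CARD('n)}"
    using assms by auto
  show "disjoint_family_on (medial_layer E) {0..CARD('n) - k + 1}"
    using medial_layers_disjoint sub by (rule disjoint_family_on_mono[rotated])
  fix i assume "i \<in> {0..CARD('n) - k + 1}"
  then have "DIM(real ^ 'n) + 1 - (CARD('n) - i + 1) = i"
    using sub by auto
  moreover have "m_rectifiable (DIM(real ^ 'n) + 1 - (CARD('n) - i + 1)) (medial_layer E i)"
    by (intro m_rectifiable_subset_medial_axis) (auto simp: medial_layer_def)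
  ultimately show "m_rectifiable i (medial_layer E i)"
    by metis
qed

end
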